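(* Let $G$ be a finite graph which is the union of two connected graphs $K$ and $H$ that have disjoint edge sets and share exactly the vertices $U=\{u_1,\ldots,u_n\}$. Let $x$ be a real number and let $D_n(x)=\big(d_{\mathcal{A}\mathcal{B}}(x)\big)_{\mathcal{A},\mathcal{B}\in\Gamma(U)}$ be any real matrix satisfying $$L_n(x)\,D_n(x)\,L_n(x)=L_n(x).$$ Then $$T(G;x,1)=\sum_{\mathcal{A},\mathcal{B}\in\Gamma(U)} d_{\mathcal{A}\mathcal{B}}(x)\,T(K/\mathcal{A};x,1)\,T(H/\mathcal{B};x,1).$$
   Context: Graphs are finite, loops and multiple edges allowed; $\omega(\cdot)$ is the number of connected components. Tutte polynomial: $T(G;x,y)=\sum_{A\subseteq G,\ V(A)=V(G)}(x-1)^{\omega(A)-\omega(G)}(y-1)^{\omega(A)+|E(A)|-|V(G)|}$, summing over spanning subgraphs. $\Gamma(U)$ is the set of partitions of $U$, ordered by $\gamma\le\gamma'$ iff $\gamma'$ refines $\gamma$; $\mathcal{A}\wedge\mathcal{B}$ is the infimum (the finest partition of which both are refinements), $|\gamma|$ is the number of blocks. $L_n(x)$ is the matrix indexed by $\Gamma(U)$ with entries $$l_{\mathcal{A}\mathcal{B}}(x)=\delta^{0}_{|\mathcal{A}\wedge\mathcal{B}|+n-|\mathcal{A}|-|\mathcal{B}|}\,(x-1)^{|\mathcal{A}\wedge\mathcal{B}|-1},$$ where $\delta^i_j$ is the Kronecker delta (and $(x-1)^0=1$). $K/\mathcal{A}$ (resp. $H/\mathcal{B}$) is obtained by identifying the vertices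 in each block of the partition into a single vertex, keeping all edges. *)

theory Defs
  imports Complex_Main "HOL-Library.Disjoint_Sets" "HOL-Library.Uprod"
begin

section \<open>Finite multigraphs\<close>

text \<open>Edges carry a name from the type \<open>'e\<close>, so parallel edges are allowed; the two ends of
  an edge form an unordered pair \<open>Upair u v\<close>, a loop being an edge with \<open>u = v\<close>.\<close>

record ('v, 'e) multigraph =
  verts :: "'v set"
  edges :: "'e set"
  ends :: "'e \<Rightarrow> 'v uprod"

definition finite_multigraph :: "('v, 'e) multigraph \<Rightarrow> bool" where
  "finite_multigraph G \<longleftrightarrow> finite (verts G) \<and> finite (edges G) \<and>
     (\<forall>e\<in>edges G. set_uprod (ends G e) \<subseteq> verts G)"

definition is_subgraph :: "('v, 'e) multigraph \<Rightarrow> ('v, 'e) multigraph \<Rightarrow> bool" where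
  "is_subgraph H G \<longleftrightarrow> finite_multigraph H \<and> verts H \<subseteq> verts G \<and> edges H \<subseteq> edges G \<and>
     (\<forall>e\<in>edges H. ends H e = ends G e)"

definition is_union_of ::
  "('v, 'e) multigraph \<Rightarrow> ('v, 'e) multigraph \<Rightarrow> ('v, 'e) multigraph \<Rightarrow> bool" where
  "is_union_of G K H \<longleftrightarrow> is_subgraph K G \<and> is_subgraph H G \<and>
     verts G = verts K \<union> verts H \<and> edges G = edges K \<union> edges H"

definition adjacent :: "('v, 'e) multigraph \<Rightarrow> ('v \<times> 'v) set" where
  "adjacent G = {(u, v). \<exists>e\<in>edges G. ends G e = Upair u v}"

definition same_component :: "('v, 'e) multigraph \<Rightarrow> ('v \<times> 'v) set" where
  "same_component G = {(u, v). u \<in> verts G \<and> v \<in> verts G \<and> (u, v) \<in> (adjacent G)\<^sup>*}"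

definition components :: "('v, 'e) multigraph \<Rightarrow> 'v set set" where
  "components G = verts G // same_component G"

definition num_components :: "('v, 'e) multigraph \<Rightarrow> nat" where
  "num_components G = card (components G)"

definition connected_multigraph :: "('v, 'e) multigraph \<Rightarrow> bool" where
  "connected_multigraph G \<longleftrightarrow> verts G \<noteq> {} \<and>
     (\<forall>u\<in>verts G. \<forall>v\<in>verts G. (u, v) \<in> (adjacent G)\<^sup>*)"


section \<open>The Tutte polynomial\<close>

text \<open>The spanning subgraphs of \<open>G\<close> are the graphs \<open>G\<lparr>edges := F\<rparr>\<close> with \<open>F \<subseteq> edges G\<close>.
  For these the natural-number subtractions below do not truncate: deleting edges cannot
  decrease the number of components, and a graph with \<open>k\<close> components has at least
  \<open>card (verts G) - k\<close> edges.\<close>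

definition tutte :: "('v, 'e) multigraph \<Rightarrow> real \<Rightarrow> real \<Rightarrow> real" where
  "tutte G x y = (\<Sum>F\<in>Pow (edges G).
     (x - 1) ^ (num_components (G\<lparr>edges := F\<rparr>) - num_components G) *
     (y - 1) ^ (num_components (G\<lparr>edges := F\<rparr>) + card F - card (verts G)))"


section \<open>Partitions and contraction\<close>

definition partitions :: "'v set \<Rightarrow> 'v set set set" where
  "partitions U = {P. partition_on U P}"

text \<open>In the order used here, \<open>P \<le> Q\<close> means that \<open>Q\<close> refines \<open>P\<close>, i.e. \<open>refines U Q P\<close>;
  so the coarsest partition is the least one, and the infimum of \<open>P\<close> and \<open>Q\<close> is the finest
  partition which both of them refine.\<close>

definition is_part_inf :: "'v set \<Rightarrow> 'v set set \<Rightarrow> 'v set set \<Rightarrow> 'v set set \<Rightarrow> bool" where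
  "is_part_inf U P Q R \<longleftrightarrow> refines U P R \<and> refines U Q R \<and>
     (\<forall>S. refines U P S \<and> refines U Q S \<longrightarrow> refines U R S)"

definition part_inf :: "'v set \<Rightarrow> 'v set set \<Rightarrow> 'v set set \<Rightarrow> 'v set set" where
  "part_inf U P Q = (THE R. is_part_inf U P Q R)"

lemma is_part_inf_part_inf:
  assumes P: "P \<in> partitions U" and Q: "Q \<in> partitions U"
  shows "is_part_inf U P Q (part_inf U P Q)"
proof -
  let ?S = "{R. refines U P R \<and> refines U Q R}"
  have part: "partition_on U R" if "R \<in> ?S" for R
    using that unfolding refines_def by blast
  have pP: "partition_on U P" and pQ: "partition_on U Q"
    using P Q unfolding partitions_def by blast+
  have ne: "?S \<noteq> {}"
  proof (cases "U = {}")
    case True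
    then have "P = {}" "Q = {}" using pP pQ by (auto simp: partition_on_empty)
    then show ?thesis using True refines_refl[OF pP] by blast
  next
    case False
    have "refines U R {U}" if "partition_on U R" for R
      using that partition_on_space[OF False] partition_onD1[OF that]
      unfolding refines_def by blast
    then show ?thesis using pP pQ by blast
  qed
  have lower: "refines U X (common_refinement ?S)" if "partition_on U X" "\<And>R. R \<in> ?S \<Longrightarrow> refines U X R" for X
    by (rule common_refinement_coarsest[OF part that ne])
  have upper: "refines U (common_refinement ?S) R" if "R \<in> ?S" for R
    by (rule refines_common_refinement[OF part that])
  have "is_part_inf U P Q (common_refinement ?S)"
    unfolding is_part_inf_def using lower[OF pP] lower[OF pQ] upper by blast
  moreover have "R = R'" if "is_part_inf U P Q R" "is_part_inf U P Q R'" for R R'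
  proof (rule refines_asym)
    show "refines U R R'" "refines U R' R"
      using that unfolding is_part_inf_def by blast+
  qed
  ultimately have "\<exists>!R. is_part_inf U P Q R"
    by blast
  then show ?thesis
    unfolding part_inf_def by (rule theI')
qed

text \<open>The vertex of the contracted graph that \<open>v\<close> becomes: the block of \<open>P\<close> containing \<open>v\<close>
  if there is one, and \<open>{v}\<close> if \<open>v\<close> lies outside all blocks.\<close>

definition block_of :: "'v set set \<Rightarrow> 'v \<Rightarrow> 'v set" where
  "block_of P v = insert v (\<Union>{X \<in> P. v \<in> X})"

definition contract :: "('v, 'e) multigraph \<Rightarrow> 'v set set \<Rightarrow> ('v set, 'e) multigraph" where
  "contract G P = \<lparr>verts = block_of P ` verts G, edges = edges G,
     ends = (\<lambda>e. map_uprod (block_of P) (ends G e))\<rparr>"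


section \<open>The matrix \<open>L\<^sub>n(x)\<close>\<close>

text \<open>The argument of the Kronecker delta is an integer and is computed in \<open>int\<close>.  For nonempty
  \<open>U\<close> the exponent \<open>card (part_inf U A B) - 1\<close> does not truncate.\<close>

definition L_mat :: "'v set \<Rightarrow> real \<Rightarrow> 'v set set \<Rightarrow> 'v set set \<Rightarrow> real" where
  "L_mat U x A B =
     (if int (card (part_inf U A B)) + int (card U) - int (card A) - int (card B) = 0
      then (x - 1) ^ (card (part_inf U A B) - 1) else 0)"

definition mat_mul :: "'i set \<Rightarrow> ('i \<Rightarrow> 'i \<Rightarrow> real) \<Rightarrow> ('i \<Rightarrow> 'i \<Rightarrow> real) \<Rightarrow> 'i \<Rightarrow> 'i \<Rightarrow> real" where
  "mat_mul I M N = (\<lambda>i j. \<Sum>k\<in>I. M i k * N k j)"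

end

theory Submission
  imports Defs
begin

text \<open>At \<open>y = 1\<close> only forests contribute. Let \<open>P\<close>, \<open>Q\<close> be the partitions of \<open>U\<close> induced by the
  components of edge sets \<open>F\<close> of \<open>K\<close> and \<open>F'\<close> of \<open>H\<close>. Counting components inside and outside
  \<open>U\<close> shows that \<open>F \<union> F'\<close> has \<open>\<omega>(F) - |P| + \<omega>(F') - |Q| + |P \<and> Q|\<close> components, and its nullity
  is the sum of the nullities of \<open>F\<close> and \<open>F'\<close> and of \<open>|P \<and> Q| + n - |P| - |Q|\<close>, which is
  nonnegative by semimodularity. Hence \<open>T(G;x,1)\<close> is a bilinear form \<open>k\<^sup>T L h\<close>, where \<open>k\<close> depends
  only on \<open>K\<close> and \<open>h\<close> only on \<open>H\<close>. The same count with a partition in place of the second graph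
  gives \<open>T(K/A;x,1) = (k\<^sup>T L)\<^sub>A\<close> and \<open>T(H/B;x,1) = (L h)\<^sub>B\<close>, so the right-hand side is
  \<open>k\<^sup>T L D L h\<close>.\<close>

section \<open>Classes of the equivalence relation generated by a symmetric relation\<close>

text \<open>The classes are not cut down to \<open>V\<close>: for symmetric \<open>R\<close> and
  \<open>U\<close> inside \<open>V\<close>, \<open>classes U R\<close> consists of exactly those
  members of \<open>classes V R\<close> that meet \<open>U\<close>.\<close>

definition classes :: "'a set \<Rightarrow> ('a \<times> 'a) set \<Rightarrow> 'a set set" where
  "classes V R = (\<lambda>v. R\<^sup>* `` {v}) ` V"

lemma finite_classes: "finite V \<Longrightarrow> finite (classes V R)"
  by (simp add: classes_def)

lemma class_eq_iff:
  assumes "sym R"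
  shows "R\<^sup>* `` {u} = R\<^sup>* `` {v} \<longleftrightarrow> (u, v) \<in> R\<^sup>*"
  using assms sym_rtrancl[OF assms] by (auto dest: symD intro: rtrancl_trans)

text \<open>Choosing a preimage under \<open>f\<close> and applying \<open>g\<close> is a bijection
  between the two images.\<close>

lemma card_image_eq_if_same_kernel:
  assumes "\<And>u v. u \<in> V \<Longrightarrow> v \<in> V \<Longrightarrow> f u = f v \<longleftrightarrow> g u = g v"
  shows "card (f ` V) = card (g ` V)"
proof -
  have "g ` V = (\<lambda>y. g (inv_into V f y)) ` f ` V"
    unfolding image_image
    by (intro image_cong refl) (metis assms f_inv_into_f imageI inv_into_into)
  moreover have "inj_on (\<lambda>y. g (inv_into V f y)) (f ` V)"
    by (intro inj_onI) (metis assms f_inv_into_f inv_into_into)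
  ultimately show ?thesis
    by (simp add: card_image)
qed

text \<open>With \<open>g\<close> the identity this compares relations whose closures agree on
  \<open>V\<close>; with \<open>g\<close> a quotient map it compares a graph with its
  contraction.\<close>

lemma card_classes_cong:
  assumes "sym R" "sym S"
    and "\<And>u v. u \<in> V \<Longrightarrow> v \<in> V \<Longrightarrow> (u, v) \<in> R\<^sup>* \<longleftrightarrow> (g u, g v) \<in> S\<^sup>*"
  shows "card (classes V R) = card (classes (g ` V) S)"
  unfolding classes_def image_image
  by (rule card_image_eq_if_same_kernel) (simp add: assms class_eq_iff)

lemma card_classes_empty: "card (classes V {}) = card V"
  unfolding classes_def by (rule card_image) (auto simp: inj_on_def)

lemma class_subset:
  assumes "R \<subseteq> V \<times> V" "v \<in> V"
  shows "R\<^sup>* `` {v} \<subseteq> V"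
proof -
  have "w \<in> V" if "(v, w) \<in> R\<^sup>*" for w
    using that by induction (use assms in auto)
  then show ?thesis by auto
qed

lemma partition_on_classes:
  assumes "sym R" "R \<subseteq> V \<times> V"
  shows "partition_on V (classes V R)"
proof (rule partition_onI)
  show "\<Union> (classes V R) = V"
    using class_subset[OF assms(2)] unfolding classes_def by auto
  show "{} \<notin> classes V R"
    unfolding classes_def by auto
  show "disjnt p q" if pq: "p \<in> classes V R" "q \<in> classes V R" "p \<noteq> q" for p q
  proof -
    obtain u v where uv: "p = R\<^sup>* `` {u}" "q = R\<^sup>* `` {v}"
      using pq unfolding classes_def by auto
    have "(u, v) \<notin> R\<^sup>*"
      using pq(3) class_eq_iff[OF assms(1)] uv by blast
    then show ?thesis
      using sym_rtrancl[OF assms(1)] unfolding uv disjnt_def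
      by (auto dest: symD) (meson rtrancl_trans symD)
  qed
qed

section \<open>Effect of added pairs on the number of classes\<close>

lemma card_classes_insert_le:
  assumes "finite V" "sym R"
  shows "card (classes V R) \<le> card (classes V (insert (a, b) (insert (b, a) R))) + 1"
proof -
  let ?R = "insert (a, b) (insert (b, a) R)"
  \<comment> \<open>Only the classes of \<open>a\<close> and \<open>b\<close> can merge, and
    \<open>?W\<close> leaves out the latter. On \<open>?W\<close> both closures agree: a path
    through the new pair has an end in the class of \<open>b\<close> or both ends in the class of
    \<open>a\<close>.\<close>
  let ?W = "{v \<in> V. (v, b) \<notin> R\<^sup>*}"
  have sR: "sym (R\<^sup>*)" "sym ?R"
    using sym_rtrancl assms(2) by (auto simp: sym_def)
  have "(u, v) \<in> R\<^sup>* \<longleftrightarrow> (u, v) \<in> ?R\<^sup>*" if "u \<in> ?W" "v \<in> ?W" for u v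
    using that sR(1) unfolding rtrancl_insert
    by (auto dest: symD intro: rtrancl_trans)
  then have "card (classes ?W R) = card (classes ((\<lambda>v. v) ` ?W) ?R)"
    by (intro card_classes_cong assms sR) auto
  also have "\<dots> \<le> card (classes V ?R)"
    by (rule card_mono) (use assms in \<open>auto simp: classes_def\<close>)
  finally have *: "card (classes ?W R) \<le> card (classes V ?R)" .
  have "classes V R \<subseteq> insert (R\<^sup>* `` {b}) (classes ?W R)"
    unfolding classes_def using class_eq_iff[OF assms(2)] by auto
  then have "card (classes V R) \<le> card (insert (R\<^sup>* `` {b}) (classes ?W R))"
    by (intro card_mono finite.insertI finite_classes) (use assms in auto)
  also have "\<dots> \<le> card (classes ?W R) + 1"
    using card_insert_le_m1 by (simp add: card_insert_if finite_classes assms)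
  finally show ?thesis using * by simp
qed

text \<open>Each pair costs at most one class. This yields both the semimodular inequality for
  partitions and the nonnegativity of the nullity of a graph.\<close>

lemma card_classes_Un_le:
  assumes "finite S" "finite V" "sym R"
  shows "card (classes V R) \<le> card (classes V (R \<union> S \<union> S\<inverse>)) + card S"
  using assms(1)
proof induction
  case (insert p S)
  obtain a b where p: "p = (a, b)" by fastforce
  have "sym (R \<union> S \<union> S\<inverse>)"
    using assms(3) by (auto simp: sym_def)
  then have "card (classes V (R \<union> S \<union> S\<inverse>))
      \<le> card (classes V (insert (a, b) (insert (b, a) (R \<union> S \<union> S\<inverse>)))) + 1"
    by (rule card_classes_insert_le[OF assms(2)])
  moreover have "insert (a, b) (insert (b, a) (R \<union> S \<union> S\<inverse>)) = R \<union> insert p S \<union> (insert p S)\<inverse>"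
    unfolding p by auto
  ultimately show ?case using insert by simp
qed simp

text \<open>\<open>S\<close> can be replaced by a star forest joining each point of \<open>U\<close>
  to a representative of its class. It has \<open>card U - card (classes U S)\<close> pairs, and
  adding them to \<open>R\<close> loses at most that many classes.\<close>

lemma card_classes_semimodular:
  assumes "finite U" "sym R" "sym S" "S \<subseteq> U \<times> U"
  shows "card (classes U R) + card (classes U S) \<le> card (classes U (R \<union> S)) + card U"
proof -
  \<comment> \<open>The choice depends on \<open>v\<close> only through its class, so equivalent
    points get the same representative.\<close>
  define r where "r v = (SOME w. w \<in> S\<^sup>* `` {v})" for v
  have rS: "(v, r v) \<in> S\<^sup>*" for v
    using someI[of "\<lambda>w. w \<in> S\<^sup>* `` {v}" v] unfolding r_def by simp
  have rI: "(u, v) \<in> S\<^sup>* \<Longrightarrow> r u = r v" for u v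
    using class_eq_iff[OF assms(3), of u v] unfolding r_def by simp
  have riff: "r u = r v \<longleftrightarrow> (u, v) \<in> S\<^sup>*" for u v
    using rI rS sym_rtrancl[OF assms(3)] by (metis rtrancl_trans symD)
  have rr: "r (r v) = r v" for v
    using rI[OF rS] by simp
  have rU: "r v \<in> U" if "v \<in> U" for v
    using class_subset[OF assms(4) that] rS by auto
  \<comment> \<open>\<open>M\<close> collects the points that are not representatives; each
    contributes one pair to the star forest \<open>T\<close>.\<close>
  define M where "M = {v \<in> U. r v \<noteq> v}"
  define T where "T = (\<lambda>v. (v, r v)) ` M"
  have "card T = card M"
    unfolding T_def by (rule card_image) (auto simp: inj_on_def)
  moreover have "U = M \<union> r ` U" "M \<inter> r ` U = {}"
    unfolding M_def using rU by (auto simp: rr) (metis imageI)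
  then have "card U = card M + card (r ` U)"
    by (metis assms(1) card_Un_disjoint finite_Un)
  moreover have "card (r ` U) = card (classes U S)"
    unfolding classes_def
    by (rule card_image_eq_if_same_kernel) (simp add: riff class_eq_iff assms)
  moreover have "card (classes U R) \<le> card (classes U (R \<union> T \<union> T\<inverse>)) + card T"
    by (rule card_classes_Un_le) (use assms in \<open>auto simp: T_def M_def\<close>)
  moreover have "(R \<union> T \<union> T\<inverse>)\<^sup>* = (R \<union> S)\<^sup>*"
  proof (rule rtrancl_subset_rtrancl[THEN subset_antisym])
    have "T \<subseteq> S\<^sup>*" "T\<inverse> \<subseteq> S\<^sup>*"
      using rS sym_rtrancl[OF assms(3)] by (auto simp: T_def dest: symD)
    then show "R \<union> T \<union> T\<inverse> \<subseteq> (R \<union> S)\<^sup>*"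
      using rtrancl_mono[of S "R \<union> S"] by auto
    show "(R \<union> S)\<^sup>* \<subseteq> (R \<union> T \<union> T\<inverse>)\<^sup>*"
    proof (rule rtrancl_subset_rtrancl, rule Un_least)
      have 1: "(v, r v) \<in> (R \<union> T \<union> T\<inverse>)\<^sup>*" "(r v, v) \<in> (R \<union> T \<union> T\<inverse>)\<^sup>*" if "v \<in> U" for v
        using that by (cases "r v = v"; force simp: T_def M_def intro: r_into_rtrancl)+
      show "S \<subseteq> (R \<union> T \<union> T\<inverse>)\<^sup>*"
      proof safe
        fix u v assume "(u, v) \<in> S"
        then have "u \<in> U" "v \<in> U" "r u = r v"
          using assms(4) riff by auto
        then show "(u, v) \<in> (R \<union> T \<union> T\<inverse>)\<^sup>*"
          using 1[of u] 1[of v] by (metis rtrancl_trans)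
      qed
    qed auto
  qed
  ultimately show ?thesis
    unfolding classes_def by simp
qed


section \<open>Gluing two relations along a common vertex set\<close>

definition trace_rel :: "'a set \<Rightarrow> ('a \<times> 'a) set \<Rightarrow> ('a \<times> 'a) set" where
  "trace_rel U R = R\<^sup>* \<inter> U \<times> U"

text \<open>Members of \<open>classes U R\<close> may contain points outside \<open>U\<close>;
  restricting the closure to \<open>U\<close> first yields a genuine partition of
  \<open>U\<close>.\<close>

definition trace :: "'a set \<Rightarrow> ('a \<times> 'a) set \<Rightarrow> 'a set set" where
  "trace U R = classes U (trace_rel U R)"

lemma sym_trace_rel: "sym R \<Longrightarrow> sym (trace_rel U R)"
  unfolding trace_rel_def by (auto intro!: symI dest: symD[OF sym_rtrancl])

lemma trace_rel_subset: "trace_rel U R \<subseteq> U \<times> U"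
  by (auto simp: trace_rel_def)

lemma rtrancl_trace_rel:
  assumes "u \<in> U" "v \<in> U"
  shows "(u, v) \<in> (trace_rel U R)\<^sup>* \<longleftrightarrow> (u, v) \<in> R\<^sup>*"
proof
  have "(trace_rel U R)\<^sup>* \<subseteq> R\<^sup>*"
    by (rule rtrancl_subset_rtrancl) (auto simp: trace_rel_def)
  then show "(u, v) \<in> (trace_rel U R)\<^sup>* \<Longrightarrow> (u, v) \<in> R\<^sup>*" by blast
qed (use assms in \<open>auto simp: trace_rel_def\<close>)

lemma trace_in_partitions: "sym R \<Longrightarrow> trace U R \<in> partitions U"
  unfolding trace_def partitions_def
  by (simp add: partition_on_classes sym_trace_rel trace_rel_subset)

lemma card_trace:
  assumes "sym R"
  shows "card (trace U R) = card (classes U R)"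
  using card_classes_cong[of "trace_rel U R" R U "\<lambda>v. v"] assms
  by (simp add: trace_def sym_trace_rel rtrancl_trace_rel)

text \<open>The blocks of the trace correspond to the classes that meet \<open>U\<close>. Hence the
  first exponent in \<open>weight\<close> does not truncate.\<close>

lemma card_trace_le:
  assumes "sym R" "U \<subseteq> V" "finite V"
  shows "card (trace U R) \<le> card (classes V R)"
  unfolding card_trace[OF assms(1)]
  by (rule card_mono) (use assms in \<open>auto simp: classes_def\<close>)

text \<open>If both partitions refine \<open>T\<close>, the blocks of \<open>T\<close> are closed
  under \<open>R\<close> and \<open>S\<close>, hence under paths in the union. So the classes of
  \<open>R \<union> S\<close> form the finest common coarsening.\<close>

lemma part_inf_classes:
  assumes "sym R" "sym S" "R \<subseteq> U \<times> U" "S \<subseteq> U \<times> U"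
  shows "part_inf U (classes U R) (classes U S) = classes U (R \<union> S)"
proof -
  let ?P = "classes U R" and ?Q = "classes U S" and ?I = "classes U (R \<union> S)"
  have symU: "sym (R \<union> S)" "R \<union> S \<subseteq> U \<times> U"
    using assms by (auto simp: sym_def)
  have parts: "partition_on U ?P" "partition_on U ?Q" "partition_on U ?I"
    by (simp_all add: partition_on_classes assms symU)
  have "refines U ?I T" if "refines U ?P T" "refines U ?Q T" for T
  proof -
    have T: "partition_on U T" using that by (simp add: refines_def)
    have ref: "\<exists>Y\<in>T. X \<subseteq> Y" if "X \<in> ?P \<union> ?Q" for X
      using that \<open>refines U ?P T\<close> \<open>refines U ?Q T\<close> unfolding refines_def by (elim UnE) simp_all
    have joined: "\<exists>Y\<in>T. u \<in> Y \<and> v \<in> Y" if uv: "(u, v) \<in> R \<union> S" for u v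
    proof -
      have "\<exists>X\<in>?P \<union> ?Q. u \<in> X \<and> v \<in> X"
        using uv symU(2) unfolding classes_def by blast
      then obtain X where "X \<in> ?P \<union> ?Q" "u \<in> X" "v \<in> X" by (elim bexE conjE)
      then show ?thesis using ref[of X] by auto
    qed
    have closed: "w \<in> Y" if "(u, w) \<in> (R \<union> S)\<^sup>*" "Y \<in> T" "u \<in> Y" for u w Y
      using that(1)
    proof induction
      case (step v w)
      then obtain Z where "Z \<in> T" "v \<in> Z" "w \<in> Z"
        using joined[of v w] by auto
      moreover have "Z = Y"
        using partition_onD2[OF T] \<open>Z \<in> T\<close> \<open>Y \<in> T\<close> \<open>v \<in> Z\<close> \<open>v \<in> Y\<close>
        by (auto simp: disjoint_def)
      ultimately show ?case by simp
    qed (rule that)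
    show ?thesis
      unfolding refines_def
    proof (intro conjI ballI)
      fix X assume "X \<in> ?I"
      then obtain u where u: "u \<in> U" "X = (R \<union> S)\<^sup>* `` {u}" by (auto simp: classes_def)
      then obtain Y where "Y \<in> T" "u \<in> Y" using partition_onD1[OF T] by auto
      then show "\<exists>Y\<in>T. X \<subseteq> Y" using closed u by blast
    qed (use parts T in auto)
  qed
  moreover have "refines U ?P ?I" "refines U ?Q ?I"
    using parts rtrancl_mono[of R "R \<union> S"] rtrancl_mono[of S "R \<union> S"]
    unfolding refines_def classes_def by auto
  ultimately have I: "is_part_inf U ?P ?Q ?I"
    by (simp add: is_part_inf_def)
  have "is_part_inf U ?P ?Q (part_inf U ?P ?Q)"
    by (rule is_part_inf_part_inf) (simp_all add: partitions_def parts)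
  with I show ?thesis
    unfolding is_part_inf_def by (metis refines_asym)
qed

section \<open>Classes that avoid the common vertices\<close>

definition missing :: "'a set \<Rightarrow> 'a set \<Rightarrow> ('a \<times> 'a) set \<Rightarrow> 'a set set" where
  "missing V U R = {X \<in> classes V R. X \<inter> U = {}}"

lemma card_classes_missing:
  assumes "finite V" "U \<subseteq> V" "sym R"
  shows "card (classes V R) = card (classes U R) + card (missing V U R)"
proof -
  have "classes V R = classes U R \<union> missing V U R"
  proof (intro subset_antisym subsetI)
    fix X assume "X \<in> classes V R"
    then obtain v where v: "v \<in> V" "X = R\<^sup>* `` {v}" by (auto simp: classes_def)
    show "X \<in> classes U R \<union> missing V U R"
    proof (cases "X \<inter> U = {}")
      case False
      then obtain u where "u \<in> U" "(v, u) \<in> R\<^sup>*" using v by auto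
      then have "X = R\<^sup>* `` {u}" using v class_eq_iff[OF assms(3)] by simp
      then show ?thesis using \<open>u \<in> U\<close> by (auto simp: classes_def)
    qed (use \<open>X \<in> classes V R\<close> in \<open>simp add: missing_def\<close>)
  qed (use assms in \<open>auto simp: classes_def missing_def\<close>)
  moreover have "classes U R \<inter> missing V U R = {}"
    by (auto simp: classes_def missing_def)
  moreover have "finite (classes U R)" "finite (missing V U R)"
    using assms by (auto simp: missing_def intro: finite_classes finite_subset)
  ultimately show ?thesis
    by (simp add: card_Un_disjoint)
qed

text \<open>A path that starts in such a class stays in \<open>V - U\<close>, which is disjoint from
  \<open>W\<close>, and so can never use a pair of \<open>S\<close>.\<close>

lemma class_Un_missing:
  assumes "R \<subseteq> V \<times> V" "S \<subseteq> W \<times> W" "V \<inter> W = U" "v \<in> V"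
    and "R\<^sup>* `` {v} \<inter> U = {}"
  shows "(R \<union> S)\<^sup>* `` {v} = R\<^sup>* `` {v}"
proof
  have "(v, w) \<in> R\<^sup>*" if "(v, w) \<in> (R \<union> S)\<^sup>*" for w
    using that
  proof induction
    case (step u w)
    then have "u \<in> V - U" using class_subset[OF assms(1,4)] assms(5) by auto
    then have "(u, w) \<notin> S" using assms(2,3) by auto
    then show ?case using step by (auto intro: rtrancl_into_rtrancl)
  qed simp
  then show "(R \<union> S)\<^sup>* `` {v} \<subseteq> R\<^sup>* `` {v}" by auto
qed (use rtrancl_mono[of R "R \<union> S"] in auto)

lemma missing_Un:
  assumes "R \<subseteq> V \<times> V" "S \<subseteq> W \<times> W" "V \<inter> W = U"
  shows "missing (V \<union> W) U (R \<union> S) = missing V U R \<union> missing W U S"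
proof -
  have one: "(R \<union> S)\<^sup>* `` {v} \<inter> U = {} \<longleftrightarrow> R\<^sup>* `` {v} \<inter> U = {}"
    if "R \<subseteq> V \<times> V" "S \<subseteq> W \<times> W" "V \<inter> W = U" "v \<in> V" for R S :: "('a \<times> 'a) set" and V W v
    using class_Un_missing[OF that] rtrancl_mono[of R "R \<union> S"] by blast
  \<comment> \<open>Stated for arbitrary relations and vertex sets, since it is applied twice with
    the two sides exchanged.\<close>
  have part: "{X \<in> classes V (R \<union> S). X \<inter> U = {}} = missing V U R"
    if "R \<subseteq> V \<times> V" "S \<subseteq> W \<times> W" "V \<inter> W = U" for R S :: "('a \<times> 'a) set" and V W
  proof -
    have image: "{X \<in> classes V T. X \<inter> U = {}} = (\<lambda>v. T\<^sup>* `` {v}) ` {v \<in> V. T\<^sup>* `` {v} \<inter> U = {}}" for T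
      by (auto simp: classes_def)
    show ?thesis
      unfolding missing_def image
      by (rule image_cong) (use one[OF that] class_Un_missing[OF that] in auto)
  qed
  have "missing (V \<union> W) U (R \<union> S)
      = {X \<in> classes V (R \<union> S). X \<inter> U = {}} \<union> {X \<in> classes W (S \<union> R). X \<inter> U = {}}"
    unfolding missing_def classes_def by (auto simp: Un_commute)
  then show ?thesis
    using part[OF assms] part[OF assms(2,1)] assms(3) by (simp add: Int_commute)
qed

lemma missing_disjoint:
  assumes "R \<subseteq> V \<times> V" "S \<subseteq> W \<times> W" "V \<inter> W = U"
  shows "missing V U R \<inter> missing W U S = {}"
proof -
  have "X \<subseteq> V \<and> X \<noteq> {}" if "X \<in> missing V U R" for X
    using that class_subset[OF assms(1)] by (auto simp: missing_def classes_def)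
  moreover have "X \<subseteq> W \<and> X \<inter> U = {}" if "X \<in> missing W U S" for X
    using that class_subset[OF assms(2)] by (auto simp: missing_def classes_def)
  ultimately show ?thesis using assms(3) by blast
qed

text \<open>A path in the union is cut into pieces at its vertices in the common set.\<close>

lemma rtrancl_Un_trace:
  assumes "R \<subseteq> V \<times> V" "S \<subseteq> W \<times> W" "V \<inter> W = U" "u \<in> U" "v \<in> U"
  shows "(u, v) \<in> (trace_rel U R \<union> trace_rel U S)\<^sup>* \<longleftrightarrow> (u, v) \<in> (R \<union> S)\<^sup>*"
proof
  let ?T = "trace_rel U R \<union> trace_rel U S"
  have "?T \<subseteq> (R \<union> S)\<^sup>*"
    using rtrancl_mono[of R "R \<union> S"] rtrancl_mono[of S "R \<union> S"] by (auto simp: trace_rel_def)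
  then show "(u, v) \<in> ?T\<^sup>* \<Longrightarrow> (u, v) \<in> (R \<union> S)\<^sup>*"
    using rtrancl_subset_rtrancl by blast
  have UV: "U \<subseteq> V" "U \<subseteq> W" using assms(3) by auto
  \<comment> \<open>Invariant along the path: \<open>t\<close> is a common vertex already reached by
    traces, and the stretch from \<open>t\<close> to \<open>w\<close> runs on one side only. When
    \<open>w\<close> is itself in \<open>U\<close>, it becomes the new \<open>t\<close>; otherwise
    the next pair stays on the same side.\<close>
  have "\<exists>t\<in>U. (u, t) \<in> ?T\<^sup>* \<and> (t, w) \<in> R\<^sup>* \<union> S\<^sup>*" if "(u, w) \<in> (R \<union> S)\<^sup>*" for w
    using that
  proof induction
    case base
    then show ?case using assms(4) by blast
  next
    case (step w w')
    then obtain t where t: "t \<in> U" "(u, t) \<in> ?T\<^sup>*" "(t, w) \<in> R\<^sup>* \<union> S\<^sup>*" by blast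
    show ?case
    proof (cases "w \<in> U")
      case True
      then have "(t, w) \<in> ?T" using t by (auto simp: trace_rel_def)
      then have "(u, w) \<in> ?T\<^sup>*" using t(2) by (rule rtrancl_into_rtrancl[rotated])
      then show ?thesis using True step(2) by blast
    next
      case False
      have "w \<in> V" if "(t, w) \<in> R\<^sup>*" using class_subset[OF assms(1)] t(1) UV that by blast
      moreover have "w \<in> W" if "(t, w) \<in> S\<^sup>*" using class_subset[OF assms(2)] t(1) UV that by blast
      ultimately have "(t, w) \<in> R\<^sup>* \<and> (w, w') \<in> R \<or> (t, w) \<in> S\<^sup>* \<and> (w, w') \<in> S"
        using False step(2) t(3) assms(1-3) by blast
      then show ?thesis using t by (meson UnI1 UnI2 rtrancl_into_rtrancl)
    qed
  qed
  moreover assume "(u, v) \<in> (R \<union> S)\<^sup>*"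
  ultimately obtain t where t: "t \<in> U" "(u, t) \<in> ?T\<^sup>*" "(t, v) \<in> R\<^sup>* \<union> S\<^sup>*" by blast
  then have "(t, v) \<in> ?T" using assms(5) by (auto simp: trace_rel_def)
  then show "(u, v) \<in> ?T\<^sup>*" using t(2) by (rule rtrancl_into_rtrancl[rotated])
qed

lemma part_inf_trace:
  assumes "sym R" "sym S"
  shows "part_inf U (trace U R) (trace U S) = classes U (trace_rel U R \<union> trace_rel U S)"
  unfolding trace_def
  by (rule part_inf_classes) (simp_all add: assms sym_trace_rel trace_rel_subset)

text \<open>Semimodularity makes the argument of the Kronecker delta in \<open>L_mat\<close>
  nonnegative at traces.\<close>

lemma card_part_inf_trace_ge:
  assumes "finite U" "sym R" "sym S"
  shows "card (trace U R) + card (trace U S) \<le> card (part_inf U (trace U R) (trace U S)) + card U"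
  unfolding part_inf_trace[OF assms(2,3)] unfolding trace_def
  by (rule card_classes_semimodular) (simp_all add: assms sym_trace_rel trace_rel_subset)

text \<open>The classes avoiding \<open>U\<close> are collected from the two sides; those meeting
  \<open>U\<close> are counted by the blocks of the traces and, after gluing, by the blocks of their
  infimum. The additive form avoids subtraction of naturals.\<close>

lemma card_classes_Un:
  assumes "finite V" "finite W" "sym R" "sym S"
    and RS: "R \<subseteq> V \<times> V" "S \<subseteq> W \<times> W" "V \<inter> W = U"
  shows "card (classes (V \<union> W) (R \<union> S)) + card (trace U R) + card (trace U S)
    = card (classes V R) + card (classes W S) + card (part_inf U (trace U R) (trace U S))"
proof -
  have U: "U \<subseteq> V" "U \<subseteq> W" "U \<subseteq> V \<union> W" using RS(3) by auto
  have sym: "sym (R \<union> S)" "sym (trace_rel U R \<union> trace_rel U S)"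
    using assms(3,4) sym_trace_rel by (auto intro: sym_Un)
  have "card (classes U (R \<union> S)) = card (part_inf U (trace U R) (trace U S))"
    using card_classes_cong[OF sym, of U "\<lambda>v. v"] rtrancl_Un_trace[OF RS]
    by (simp add: part_inf_trace assms)
  moreover have "card (missing (V \<union> W) U (R \<union> S)) = card (missing V U R) + card (missing W U S)"
    unfolding missing_Un[OF RS]
    by (rule card_Un_disjoint[OF _ _ missing_disjoint[OF RS]])
      (simp_all add: missing_def finite_classes assms)
  moreover have "finite (V \<union> W)" using assms by simp
  ultimately show ?thesis
    using card_classes_missing[of V U R] card_classes_missing[of W U S]
      card_classes_missing[of "V \<union> W" U "R \<union> S"] U sym assms
    by (simp add: card_trace)
qed


section \<open>The relation of a partition\<close>

text \<open>A partition becomes a relation so that it can be glued to a graph like a second graph.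
  It is reflexive only on the union of the blocks.\<close>

definition rel_of :: "'a set set \<Rightarrow> ('a \<times> 'a) set" where
  "rel_of P = {(u, v). \<exists>X\<in>P. u \<in> X \<and> v \<in> X}"

lemma sym_rel_of: "sym (rel_of P)"
  by (auto simp: rel_of_def sym_def)

lemma rel_of_subset:
  assumes "partition_on U P"
  shows "rel_of P \<subseteq> U \<times> U"
  using partition_onD1[OF assms] by (auto simp: rel_of_def)

lemma trans_rel_of:
  assumes "partition_on U P"
  shows "trans (rel_of P)"
proof (rule transI)
  fix u v w assume "(u, v) \<in> rel_of P" "(v, w) \<in> rel_of P"
  then obtain X Y where XY: "X \<in> P" "u \<in> X" "v \<in> X" "Y \<in> P" "v \<in> Y" "w \<in> Y"
    by (auto simp: rel_of_def)
  then have "X = Y" using partition_onD2[OF assms] by (auto simp: disjoint_def)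
  then show "(u, w) \<in> rel_of P" using XY by (auto simp: rel_of_def)
qed

text \<open>\<open>rel_of P\<close> is transitive, so its closure only adds \<open>Id\<close>, which
  matches the singleton that \<open>block_of\<close> assigns outside all blocks.\<close>

lemma block_of_eq_class:
  assumes "partition_on U P"
  shows "block_of P v = (rel_of P)\<^sup>* `` {v}"
proof -
  have "(rel_of P)\<^sup>* = rel_of P \<union> Id"
    by (simp add: rtrancl_trancl_reflcl trancl_id[OF trans_rel_of[OF assms]])
  then show ?thesis by (auto simp: block_of_def rel_of_def)
qed

lemma classes_rel_of:
  assumes "partition_on U P"
  shows "classes U (rel_of P) = P"
proof -
  have eq: "block_of P u = X" if "X \<in> P" "u \<in> X" for u X
  proof -
    have "{Y \<in> P. u \<in> Y} = {X}"
      using that partition_onD2[OF assms] by (auto simp: disjoint_def)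
    then show ?thesis using that by (auto simp: block_of_def)
  qed
  have "block_of P ` U = P"
  proof (intro subset_antisym subsetI)
    fix X assume X: "X \<in> P"
    then obtain u where "u \<in> X" using partition_onD3[OF assms] by fastforce
    then show "X \<in> block_of P ` U"
      using X eq partition_onD1[OF assms] by blast
  qed (use eq partition_onD1[OF assms] in auto)
  then show ?thesis
    by (simp add: classes_def block_of_eq_class[OF assms])
qed

lemma trace_rel_of:
  assumes "partition_on U P"
  shows "trace U (rel_of P) = P"
proof -
  have "(rel_of P)\<^sup>* \<inter> U \<times> U = rel_of P"
  proof -
    have "(rel_of P)\<^sup>* = rel_of P \<union> Id"
      by (simp add: rtrancl_trancl_reflcl trancl_id[OF trans_rel_of[OF assms]])
    moreover have "(u, u) \<in> rel_of P" if "u \<in> U" for u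
      using that partition_onD1[OF assms] by (auto simp: rel_of_def)
    ultimately show ?thesis using rel_of_subset[OF assms] by auto
  qed
  then show ?thesis
    by (simp add: trace_def trace_rel_def classes_rel_of assms)
qed

lemma card_block_of_image:
  assumes "partition_on U P" "finite V" "U \<subseteq> V"
  shows "card (block_of P ` V) + card U = card V + card P"
proof -
  \<comment> \<open>Gluing the empty relation on \<open>V\<close> to \<open>rel_of P\<close> on
    \<open>U\<close> shows that the points outside \<open>U\<close> remain singletons, while
    \<open>U\<close> itself shrinks to the blocks of \<open>P\<close>.\<close>
  have "missing (V \<union> U) U ({} \<union> rel_of P) = missing V U {} \<union> missing U U (rel_of P)"
    by (rule missing_Un) (use assms rel_of_subset in auto)
  moreover have "missing U U (rel_of P) = {}"
    by (auto simp: missing_def classes_def)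
  moreover have "V \<union> U = V" using assms by auto
  ultimately have "missing V U (rel_of P) = missing V U {}" by simp
  moreover have "block_of P ` V = classes V (rel_of P)"
    by (simp add: classes_def block_of_eq_class[OF assms(1)])
  ultimately show ?thesis
    using card_classes_missing[OF assms(2,3) sym_rel_of, of P]
      card_classes_missing[OF assms(2,3), of "{}"]
    by (simp add: classes_rel_of assms card_classes_empty)
qed

section \<open>Paths in a quotient\<close>

text \<open>\<open>E\<close> generates the kernel of \<open>f\<close>. A path in the image lifts
  edge by edge, the gaps between consecutive lifts being bridged inside fibres by
  \<open>E\<close>.\<close>

lemma rtrancl_image_kernel:
  assumes "\<And>u v. f u = f v \<longleftrightarrow> (u, v) \<in> E\<^sup>*"
  shows "(u, v) \<in> (R \<union> E)\<^sup>* \<longleftrightarrow> (f u, f v) \<in> (map_prod f f ` R)\<^sup>*"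
proof
  assume "(u, v) \<in> (R \<union> E)\<^sup>*"
  then show "(f u, f v) \<in> (map_prod f f ` R)\<^sup>*"
  proof induction
    case (step v w)
    from step(2) consider "(v, w) \<in> R" | "(v, w) \<in> E" by blast
    then show ?case
    proof cases
      case 1
      then have "(f v, f w) \<in> map_prod f f ` R" by force
      with step(3) show ?thesis by (rule rtrancl_into_rtrancl)
    next
      case 2
      then have "f v = f w" using assms by blast
      with step(3) show ?thesis by simp
    qed
  qed simp
next
  have E: "(v, w) \<in> (R \<union> E)\<^sup>*" if "f v = f w" for v w
    using that assms rtrancl_mono[of E "R \<union> E"] by blast
  assume "(f u, f v) \<in> (map_prod f f ` R)\<^sup>*"
  then show "(u, v) \<in> (R \<union> E)\<^sup>*"
  proof (induction "f v" arbitrary: v)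
    case base
    then show ?case using E by simp
  next
    case (step b)
    then obtain p q where pq: "(p, q) \<in> R" "b = f p" "f q = f v" by auto
    then have "(u, p) \<in> (R \<union> E)\<^sup>*" using step by simp
    also have "(p, q) \<in> (R \<union> E)\<^sup>*" using pq by auto
    also have "(q, v) \<in> (R \<union> E)\<^sup>*" using E pq by simp
    finally show ?case .
  qed
qed


section \<open>Components of multigraphs\<close>

lemma sym_adjacent:
  fixes G :: "('v, 'e) multigraph"
  shows "sym (adjacent G)"
proof (rule symI)
  fix u v :: 'v
  have "Upair u v = Upair v u" by simp
  then show "(u, v) \<in> adjacent G \<Longrightarrow> (v, u) \<in> adjacent G"
    by (simp add: adjacent_def)
qed

lemma adjacent_subset: "finite_multigraph G \<Longrightarrow> adjacent G \<subseteq> verts G \<times> verts G"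
  by (force simp: adjacent_def finite_multigraph_def)

lemma finite_multigraph_edges_update:
  "finite_multigraph G \<Longrightarrow> F \<subseteq> edges G \<Longrightarrow> finite_multigraph (G\<lparr>edges := F\<rparr>)"
  by (auto simp: finite_multigraph_def intro: finite_subset)

lemma num_components_eq_card_classes:
  assumes "finite_multigraph G"
  shows "num_components G = card (classes (verts G) (adjacent G))"
proof -
  have "same_component G `` {v} = (adjacent G)\<^sup>* `` {v}" if "v \<in> verts G" for v
    using that class_subset[OF adjacent_subset[OF assms] that] by (auto simp: same_component_def)
  then have "components G = classes (verts G) (adjacent G)"
    by (auto simp: components_def classes_def quotient_def)
  then show ?thesis by (simp add: num_components_def)
qed

lemma num_components_connected:
  assumes "finite_multigraph G" "connected_multigraph G"
  shows "num_components G = 1"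
proof -
  obtain u where u: "u \<in> verts G"
    using assms(2) by (auto simp: connected_multigraph_def)
  have "(adjacent G)\<^sup>* `` {v} = (adjacent G)\<^sup>* `` {u}" if "v \<in> verts G" for v
    using assms(2) that u by (simp add: class_eq_iff sym_adjacent connected_multigraph_def)
  then have "classes (verts G) (adjacent G) = (\<lambda>_. (adjacent G)\<^sup>* `` {u}) ` verts G"
    unfolding classes_def by (intro image_cong refl)
  also have "\<dots> = {(adjacent G)\<^sup>* `` {u}}"
    using u by auto
  finally show ?thesis by (simp add: num_components_eq_card_classes assms)
qed

text \<open>The edgeless graph has one class per vertex, and each edge merges at most two classes.
  So the nullity exponent does not truncate.\<close>

lemma card_verts_le:
  assumes "finite_multigraph G"
  shows "card (verts G) \<le> num_components G + card (edges G)"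
proof -
  \<comment> \<open>An arbitrary orientation \<open>p\<close> of the edges writes adjacency as
    \<open>?S\<close> with its converse; parallel edges may share a pair, so \<open>?S\<close> has
    at most as many elements as there are edges.\<close>
  have "\<exists>p. ends G e = Upair (fst p) (snd p)" for e
    by (metis fst_conv snd_conv uprod_exhaust)
  then obtain p where p: "\<And>e. ends G e = Upair (fst (p e)) (snd (p e))"
    by metis
  have fin: "finite (verts G)" "finite (edges G)"
    using assms by (auto simp: finite_multigraph_def)
  let ?S = "p ` edges G"
  have "adjacent G = {} \<union> ?S \<union> ?S\<inverse>"
    unfolding adjacent_def p by (force simp: Upair_inject image_iff prod_eq_iff)
  moreover have "card (classes (verts G) {}) \<le> card (classes (verts G) ({} \<union> ?S \<union> ?S\<inverse>)) + card ?S"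
    by (rule card_classes_Un_le) (use fin in \<open>auto simp: sym_def\<close>)
  moreover have "card ?S \<le> card (edges G)"
    using fin by (intro card_image_le)
  ultimately show ?thesis
    by (simp add: num_components_eq_card_classes assms card_classes_empty)
qed

section \<open>Contraction and connectivity\<close>

lemma verts_contract [simp]: "verts (contract K A) = block_of A ` verts K"
  and edges_contract [simp]: "edges (contract K A) = edges K"
  by (simp_all add: contract_def)

text \<open>Thus the spanning subgraphs of a contraction are the contractions of spanning
  subgraphs.\<close>

lemma contract_edges_update: "(contract K A)\<lparr>edges := F\<rparr> = contract (K\<lparr>edges := F\<rparr>) A"
  by (simp add: contract_def)

lemma finite_multigraph_contract: "finite_multigraph K \<Longrightarrow> finite_multigraph (contract K A)"
  by (auto simp: finite_multigraph_def contract_def uprod.set_map)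

lemma adjacent_contract:
  "adjacent (contract K A) = map_prod (block_of A) (block_of A) ` adjacent K"
proof -
  let ?f = "block_of A"
  have "map_uprod ?f z = Upair a b \<longleftrightarrow> (\<exists>u v. z = Upair u v \<and> a = ?f u \<and> b = ?f v)" for z a b
    by (cases z) (auto simp: Upair_inject)
  then show ?thesis
    unfolding adjacent_def contract_def by (fastforce simp: image_iff)
qed

text \<open>The fibres of \<open>block_of A\<close> are the classes of \<open>rel_of A\<close>, so
  for connectivity contracting amounts to adding \<open>rel_of A\<close>.\<close>

lemma adjacent_contract_rtrancl:
  assumes "partition_on U A"
  shows "(block_of A u, block_of A v) \<in> (adjacent (contract K A))\<^sup>*
    \<longleftrightarrow> (u, v) \<in> (adjacent K \<union> rel_of A)\<^sup>*"
  unfolding adjacent_contract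
  by (rule rtrancl_image_kernel[symmetric])
    (simp add: block_of_eq_class[OF assms] class_eq_iff sym_rel_of)

lemma num_components_contract:
  assumes "finite_multigraph K" "partition_on U A"
  shows "num_components (contract K A) = card (classes (verts K) (adjacent K \<union> rel_of A))"
  using card_classes_cong[of "adjacent K \<union> rel_of A" "adjacent (contract K A)" "verts K" "block_of A"]
  by (simp add: num_components_eq_card_classes finite_multigraph_contract assms
      sym_adjacent sym_rel_of sym_Un adjacent_contract_rtrancl[OF assms(2)])

lemma connected_contract:
  assumes "connected_multigraph K" "partition_on U A"
  shows "connected_multigraph (contract K A)"
  using assms(1) rtrancl_mono[of "adjacent K" "adjacent K \<union> rel_of A"]
  by (auto simp: connected_multigraph_def adjacent_contract_rtrancl[OF assms(2)])


section \<open>Splitting the Tutte polynomial\<close>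

text \<open>The part of a term that depends on one side alone: the first exponent counts the
  components avoiding \<open>U\<close>, and the power of \<open>0\<close> is \<open>1\<close> for
  forests and \<open>0\<close> otherwise, as \<open>0 ^ 0 = 1\<close>.\<close>

definition weight :: "'v set \<Rightarrow> real \<Rightarrow> ('v, 'e) multigraph \<Rightarrow> real" where
  "weight U x K = (x - 1) ^ (num_components K - card (trace U (adjacent K))) *
     0 ^ (num_components K + card (edges K) - card (verts K))"

text \<open>The arithmetic shared by gluing and contraction: \<open>w\<close>, \<open>w1\<close>,
  \<open>w2\<close> stand for component numbers, \<open>p\<close>, \<open>q\<close>,
  \<open>i\<close> for block numbers of the traces and their infimum, \<open>m1\<close>,
  \<open>m2\<close> for edge numbers, \<open>N\<close>, \<open>N1\<close>, \<open>N2\<close> for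
  vertex numbers and \<open>n\<close> for \<open>card U\<close>. The inequalities exclude
  truncation.\<close>

lemma glue_powers:
  fixes a :: real and w w1 w2 p q i n m1 m2 N N1 N2 :: nat
  assumes "w + p + q = w1 + w2 + i" "p \<le> w1" "q \<le> w2" "1 \<le> i" "p + q \<le> i + n"
    and "N1 \<le> w1 + m1" "N2 \<le> w2 + m2" "N + n = N1 + N2"
  shows "a ^ (w - 1) * 0 ^ (w + (m1 + m2) - N) =
    (a ^ (w1 - p) * 0 ^ (w1 + m1 - N1)) *
    (if int i + int n - int p - int q = 0 then a ^ (i - 1) else 0) *
    (a ^ (w2 - q) * 0 ^ (w2 + m2 - N2))"
proof -
  have "w - 1 = (w1 - p) + (w2 - q) + (i - 1)"
    using assms by linarith
  moreover have "w + (m1 + m2) - N = (w1 + m1 - N1) + (w2 + m2 - N2) + (i + n - (p + q))"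
    using assms by linarith
  \<comment> \<open>The Kronecker delta is itself a power of \<open>0\<close>, so it is absorbed as
    the third summand of the nullity.\<close>
  moreover have "(if int i + int n - int p - int q = 0 then a ^ (i - 1) else 0) =
      a ^ (i - 1) * 0 ^ (i + n - (p + q))"
    using assms(5) by auto
  ultimately show ?thesis
    by (simp only: power_add mult_ac)
qed

lemma card_part_inf_pos:
  assumes "finite U" "U \<noteq> {}" "sym R" "sym S"
  shows "1 \<le> card (part_inf U (trace U R) (trace U S))"
  unfolding part_inf_trace[OF assms(3,4)]
  using assms by (simp add: Suc_le_eq card_gt_0_iff finite_classes) (simp add: classes_def)

lemma L_mat_sym:
  assumes "A \<in> partitions U" "B \<in> partitions U"
  shows "L_mat U x A B = L_mat U x B A"
proof -
  have "is_part_inf U A B = is_part_inf U B A"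
    by (rule ext) (auto simp: is_part_inf_def)
  then have "part_inf U A B = part_inf U B A"
    by (simp add: part_inf_def)
  then show ?thesis by (simp add: L_mat_def algebra_simps)
qed

text \<open>In \<open>K/A\<close> the partition \<open>A\<close> plays the role of a second graph, with vertex set \<open>U\<close>.\<close>

lemma term_contract:
  assumes K: "finite_multigraph K" and U: "U \<subseteq> verts K" "U \<noteq> {}" and A: "A \<in> partitions U"
  shows "(x - 1) ^ (num_components (contract K A) - 1) *
      0 ^ (num_components (contract K A) + card (edges K) - card (verts (contract K A)))
    = weight U x K * L_mat U x (trace U (adjacent K)) A"
proof -
  have pA: "partition_on U A" using A by (simp add: partitions_def)
  have fin: "finite (verts K)" "finite U"
    using K U finite_subset by (auto simp: finite_multigraph_def)
  note [simp] = trace_rel_of[OF pA] classes_rel_of[OF pA] num_components_contract[OF K pA]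
  have VU: "verts K \<union> U = verts K" "verts K \<inter> U = U" using U by auto
  \<comment> \<open>The second side contributes \<open>card A\<close> components,
    \<open>card A\<close> vertices and \<open>0\<close> edges, so its factor in the last line is
    \<open>1\<close>.\<close>
  have "(x - 1) ^ (num_components (contract K A) - 1) *
      0 ^ (num_components (contract K A) + (card (edges K) + 0) - card (verts (contract K A)))
    = (x - 1) ^ (num_components K - card (trace U (adjacent K))) *
      0 ^ (num_components K + card (edges K) - card (verts K)) *
      (if int (card (part_inf U (trace U (adjacent K)) A)) + int (card U)
          - int (card (trace U (adjacent K))) - int (card A) = 0
       then (x - 1) ^ (card (part_inf U (trace U (adjacent K)) A) - 1) else 0) *
      ((x - 1) ^ (card A - card A) * 0 ^ (card A + 0 - card A))"
  proof (rule glue_powers)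
    show "num_components (contract K A) + card (trace U (adjacent K)) + card A
        = num_components K + card A + card (part_inf U (trace U (adjacent K)) A)"
      using card_classes_Un[OF fin sym_adjacent[of K] sym_rel_of[of A] adjacent_subset[OF K]
          rel_of_subset[OF pA] VU(2)]
      by (simp add: VU num_components_eq_card_classes[OF K])
    show "card (trace U (adjacent K)) \<le> num_components K"
      using card_trace_le[OF sym_adjacent U(1) fin(1)]
      by (simp add: num_components_eq_card_classes[OF K])
    show "1 \<le> card (part_inf U (trace U (adjacent K)) A)"
      using card_part_inf_pos[OF fin(2) U(2) sym_adjacent[of K] sym_rel_of[of A]] by simp
    show "card (trace U (adjacent K)) + card A
        \<le> card (part_inf U (trace U (adjacent K)) A) + card U"
      using card_part_inf_trace_ge[OF fin(2) sym_adjacent[of K] sym_rel_of[of A]] by simp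
    show "card (verts (contract K A)) + card U = card (verts K) + card A"
      using card_block_of_image[OF pA fin(1) U(1)] by simp
  qed (use card_verts_le[OF K] in simp_all)
  then show ?thesis by (simp add: weight_def L_mat_def)
qed

text \<open>\<open>contract K A\<close> is connected, which turns the exponent of
  \<open>x - 1\<close> into the one handled by \<open>term_contract\<close>; the terms then agree
  edge set by edge set.\<close>

lemma tutte_contract:
  assumes K: "finite_multigraph K" and "connected_multigraph K"
    and U: "U \<subseteq> verts K" "U \<noteq> {}" and A: "A \<in> partitions U"
  shows "tutte (contract K A) x 1 =
    (\<Sum>F\<in>Pow (edges K). weight U x (K\<lparr>edges := F\<rparr>) *
      L_mat U x (trace U (adjacent (K\<lparr>edges := F\<rparr>))) A)"
proof -
  have pA: "partition_on U A" using A by (simp add: partitions_def)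
  have "num_components (contract K A) = 1"
    using num_components_connected connected_contract finite_multigraph_contract assms(1,2) pA
    by blast
  moreover have "(x - 1) ^ (num_components (contract (K\<lparr>edges := F\<rparr>) A) - 1) *
      0 ^ (num_components (contract (K\<lparr>edges := F\<rparr>) A) + card F - card (verts (contract K A)))
    = weight U x (K\<lparr>edges := F\<rparr>) * L_mat U x (trace U (adjacent (K\<lparr>edges := F\<rparr>))) A"
    if "F \<in> Pow (edges K)" for F
    using term_contract[OF finite_multigraph_edges_update[OF K, of F], of U A x] U A that by simp
  ultimately show ?thesis
    by (simp add: tutte_def contract_edges_update)
qed

text \<open>Edge numbers add because the edge sets are disjoint, and vertex numbers add up to the
  overlap \<open>card U\<close>; the rest is \<open>glue_powers\<close>.\<close>

lemma term_union:
  assumes G: "finite_multigraph G" and K: "finite_multigraph K" and H: "finite_multigraph H"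
    and verts: "verts G = verts K \<union> verts H" and U: "verts K \<inter> verts H = U" "U \<noteq> {}"
    and adj: "adjacent G = adjacent K \<union> adjacent H"
    and edges: "edges G = edges K \<union> edges H" "edges K \<inter> edges H = {}"
  shows "(x - 1) ^ (num_components G - 1) *
      0 ^ (num_components G + card (edges G) - card (verts G))
    = weight U x K * L_mat U x (trace U (adjacent K)) (trace U (adjacent H)) * weight U x H"
proof -
  have fin: "finite (verts K)" "finite (verts H)" "finite (edges K)" "finite (edges H)" "finite U"
    using K H U by (auto simp: finite_multigraph_def)
  have "card (edges G) = card (edges K) + card (edges H)"
    using edges fin by (simp add: card_Un_disjoint)
  moreover have "(x - 1) ^ (num_components G - 1) *
      0 ^ (num_components G + (card (edges K) + card (edges H)) - card (verts G))
    = weight U x K * L_mat U x (trace U (adjacent K)) (trace U (adjacent H)) * weight U x H"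
    unfolding weight_def L_mat_def
  proof (rule glue_powers)
    show "num_components G + card (trace U (adjacent K)) + card (trace U (adjacent H))
        = num_components K + num_components H
          + card (part_inf U (trace U (adjacent K)) (trace U (adjacent H)))"
      using card_classes_Un[OF fin(1,2) sym_adjacent sym_adjacent adjacent_subset[OF K]
          adjacent_subset[OF H] U(1)]
      by (simp add: num_components_eq_card_classes G K H adj verts)
    show "card (trace U (adjacent K)) \<le> num_components K"
      "card (trace U (adjacent H)) \<le> num_components H"
      using card_trace_le[OF sym_adjacent[of K] _ fin(1), of U]
        card_trace_le[OF sym_adjacent[of H] _ fin(2), of U] U(1)[symmetric]
      by (simp_all add: num_components_eq_card_classes K H)
    show "card (verts G) + card U = card (verts K) + card (verts H)"
      using card_Un_Int[OF fin(1,2)] U verts by simp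
    show "1 \<le> card (part_inf U (trace U (adjacent K)) (trace U (adjacent H)))"
      by (rule card_part_inf_pos[OF fin(5) U(2) sym_adjacent sym_adjacent])
  qed (simp_all add: card_part_inf_trace_ge card_verts_le K H fin U sym_adjacent)
  ultimately show ?thesis by simp
qed

lemma adjacent_union:
  assumes "is_union_of G K H" "F \<subseteq> edges K" "F' \<subseteq> edges H"
  shows "adjacent (G\<lparr>edges := F \<union> F'\<rparr>) = adjacent (K\<lparr>edges := F\<rparr>) \<union> adjacent (H\<lparr>edges := F'\<rparr>)"
proof -
  have "ends G e = ends K e" if "e \<in> F" for e
    using assms that by (auto simp: is_union_of_def is_subgraph_def)
  moreover have "ends G e = ends H e" if "e \<in> F'" for e
    using assms that by (auto simp: is_union_of_def is_subgraph_def)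
  ultimately show ?thesis by (auto simp: adjacent_def bex_Un cong: bex_cong_simp)
qed

lemma connected_union:
  assumes "is_union_of G K H" "connected_multigraph K" "connected_multigraph H"
    and "verts K \<inter> verts H \<noteq> {}"
  shows "connected_multigraph G"
proof -
  have "adjacent K \<subseteq> adjacent G" "adjacent H \<subseteq> adjacent G"
    using assms(1) by (auto simp: adjacent_def is_union_of_def is_subgraph_def)
  then have sub: "(adjacent K)\<^sup>* \<subseteq> (adjacent G)\<^sup>*" "(adjacent H)\<^sup>* \<subseteq> (adjacent G)\<^sup>*"
    by (simp_all add: rtrancl_mono)
  obtain u where u: "u \<in> verts K" "u \<in> verts H" using assms(4) by auto
  have "(v, u) \<in> (adjacent G)\<^sup>* \<and> (u, v) \<in> (adjacent G)\<^sup>*" if "v \<in> verts G" for v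
    using that u sub assms(1-3) unfolding is_union_of_def connected_multigraph_def by blast
  then show ?thesis
    using u assms(1) unfolding connected_multigraph_def is_union_of_def
    by (auto intro: rtrancl_trans)
qed

lemma tutte_union:
  assumes G: "finite_multigraph G" and GKH: "is_union_of G K H"
    and conn: "connected_multigraph K" "connected_multigraph H"
    and disj: "edges K \<inter> edges H = {}" and U: "verts K \<inter> verts H = U" "U \<noteq> {}"
  shows "tutte G x 1 = (\<Sum>F\<in>Pow (edges K). \<Sum>F'\<in>Pow (edges H).
    weight U x (K\<lparr>edges := F\<rparr>) *
    L_mat U x (trace U (adjacent (K\<lparr>edges := F\<rparr>))) (trace U (adjacent (H\<lparr>edges := F'\<rparr>))) *
    weight U x (H\<lparr>edges := F'\<rparr>))"
proof -
  have KH: "finite_multigraph K" "finite_multigraph H"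
    and verts: "verts G = verts K \<union> verts H" and edges: "edges G = edges K \<union> edges H"
    using GKH by (auto simp: is_union_of_def is_subgraph_def)
  have one: "num_components G = 1"
    using num_components_connected[OF G] connected_union[OF GKH conn] U by simp
  let ?t = "\<lambda>F. (x - 1) ^ (num_components (G\<lparr>edges := F\<rparr>) - 1) *
      0 ^ (num_components (G\<lparr>edges := F\<rparr>) + card F - card (verts G))"
  have "tutte G x 1 = (\<Sum>F\<in>Pow (edges G). ?t F)"
    by (simp add: tutte_def one)
  \<comment> \<open>As the edge sets are disjoint, an edge set of \<open>G\<close> is determined by
    its intersections with the two sides, which can be prescribed freely.\<close>
  also have "\<dots> = (\<Sum>(F, F')\<in>Pow (edges K) \<times> Pow (edges H). ?t (F \<union> F'))"
    by (rule sum.reindex_bij_witness[where i = "\<lambda>(F, F'). F \<union> F'"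
          and j = "\<lambda>F. (F \<inter> edges K, F \<inter> edges H)"])
      (use edges disj in \<open>auto simp: Int_Un_distrib[symmetric] Int_absorb2 simp del: Int_Un_distrib
        intro: arg_cong[where f = ?t]\<close>)
  also have "\<dots> = (\<Sum>F\<in>Pow (edges K). \<Sum>F'\<in>Pow (edges H). ?t (F \<union> F'))"
    by (rule sum.cartesian_product[symmetric])
  also have "\<dots> = (\<Sum>F\<in>Pow (edges K). \<Sum>F'\<in>Pow (edges H). weight U x (K\<lparr>edges := F\<rparr>) *
    L_mat U x (trace U (adjacent (K\<lparr>edges := F\<rparr>))) (trace U (adjacent (H\<lparr>edges := F'\<rparr>))) *
    weight U x (H\<lparr>edges := F'\<rparr>))"
  proof (intro sum.cong refl)
    fix F F' assume F: "F \<in> Pow (edges K)" "F' \<in> Pow (edges H)"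
    then have "finite_multigraph (G\<lparr>edges := F \<union> F'\<rparr>)"
      "finite_multigraph (K\<lparr>edges := F\<rparr>)" "finite_multigraph (H\<lparr>edges := F'\<rparr>)"
      using G KH edges by (auto intro!: finite_multigraph_edges_update)
    then show "?t (F \<union> F') = weight U x (K\<lparr>edges := F\<rparr>) *
      L_mat U x (trace U (adjacent (K\<lparr>edges := F\<rparr>))) (trace U (adjacent (H\<lparr>edges := F'\<rparr>))) *
      weight U x (H\<lparr>edges := F'\<rparr>)"
      using term_union[of "G\<lparr>edges := F \<union> F'\<rparr>" "K\<lparr>edges := F\<rparr>" "H\<lparr>edges := F'\<rparr>" U x]
        F verts U disj adjacent_union[OF GKH, of F F'] by auto
  qed
  finally show ?thesis .
qed

section \<open>Evaluation of the bilinear form\<close>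

lemma sum_swap_pairs:
  "(\<Sum>a\<in>A. \<Sum>b\<in>B. \<Sum>c\<in>C. \<Sum>d\<in>E. f a b c d) =
    (\<Sum>c\<in>C. \<Sum>d\<in>E. \<Sum>a\<in>A. \<Sum>b\<in>B. (f a b c d :: 'm :: comm_monoid_add))"
proof -
  have "(\<Sum>a\<in>A. \<Sum>b\<in>B. \<Sum>c\<in>C. \<Sum>d\<in>E. f a b c d)
      = (\<Sum>a\<in>A. \<Sum>c\<in>C. \<Sum>b\<in>B. \<Sum>d\<in>E. f a b c d)"
    by (rule sum.cong[OF refl], rule sum.swap)
  also have "\<dots> = (\<Sum>a\<in>A. \<Sum>c\<in>C. \<Sum>d\<in>E. \<Sum>b\<in>B. f a b c d)"
    by (rule sum.cong[OF refl], rule sum.cong[OF refl], rule sum.swap)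
  also have "\<dots> = (\<Sum>c\<in>C. \<Sum>a\<in>A. \<Sum>d\<in>E. \<Sum>b\<in>B. f a b c d)"
    by (rule sum.swap)
  also have "\<dots> = (\<Sum>c\<in>C. \<Sum>d\<in>E. \<Sum>a\<in>A. \<Sum>b\<in>B. f a b c d)"
    by (rule sum.cong[OF refl], rule sum.swap)
  finally show ?thesis .
qed

theorem theorem2:
  fixes G K H :: "('v, 'e) multigraph" and U :: "'v set" and x :: real
    and D :: "'v set set \<Rightarrow> 'v set set \<Rightarrow> real"
  assumes "finite_multigraph G"
    and "is_union_of G K H"
    and "connected_multigraph K"
    and "connected_multigraph H"
    and "edges K \<inter> edges H = {}"
    and "verts K \<inter> verts H = U"
    and "U \<noteq> {}"
    and "\<forall>A\<in>partitions U. \<forall>B\<in>partitions U.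
           mat_mul (partitions U) (mat_mul (partitions U) (L_mat U x) D) (L_mat U x) A B
             = L_mat U x A B"
  shows "tutte G x 1 =
    (\<Sum>A\<in>partitions U. \<Sum>B\<in>partitions U.
       D A B * tutte (contract K A) x 1 * tutte (contract H B) x 1)"
proof -
  let ?\<Gamma> = "partitions U" and ?L = "L_mat U x"
  let ?EK = "Pow (edges K)" and ?EH = "Pow (edges H)"
  \<comment> \<open>The coefficient vectors stay indexed by edge sets, without collecting those of
    equal trace; \<open>P\<close> and \<open>Q\<close> supply the row and column of
    \<open>L_mat\<close>.\<close>
  define k where "k F = weight U x (K\<lparr>edges := F\<rparr>)" for F
  define h where "h F = weight U x (H\<lparr>edges := F\<rparr>)" for F
  define P where "P F = trace U (adjacent (K\<lparr>edges := F\<rparr>))" for F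
  define Q where "Q F = trace U (adjacent (H\<lparr>edges := F\<rparr>))" for F
  have fin: "finite_multigraph K" "finite_multigraph H"
    using assms(2) by (auto simp: is_union_of_def is_subgraph_def)
  have sub: "U \<subseteq> verts K" "U \<subseteq> verts H"
    using assms(6) by auto
  have P: "P F \<in> ?\<Gamma>" and Q: "Q F \<in> ?\<Gamma>" for F
    by (simp_all add: P_def Q_def trace_in_partitions sym_adjacent)
  have tK: "tutte (contract K A) x 1 = (\<Sum>F\<in>?EK. k F * ?L (P F) A)" if "A \<in> ?\<Gamma>" for A
    using tutte_contract[OF fin(1) assms(3) sub(1) assms(7) that] by (simp add: k_def P_def)
  \<comment> \<open>Symmetry of \<open>L_mat\<close> moves \<open>B\<close> to the row index, so
    that \<open>D\<close> stands between two copies of \<open>L_mat\<close>.\<close>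
  have tH: "tutte (contract H B) x 1 = (\<Sum>F\<in>?EH. ?L B (Q F) * h F)" if "B \<in> ?\<Gamma>" for B
    using tutte_contract[OF fin(2) assms(4) sub(2) assms(7) that] L_mat_sym[OF that Q]
    by (simp add: h_def Q_def mult.commute)
  \<comment> \<open>The hypothesis on \<open>D\<close>, read at one entry; \<open>mat_mul\<close>
    sums over \<open>B\<close> outermost, hence the swap.\<close>
  have LDL: "(\<Sum>A\<in>?\<Gamma>. \<Sum>B\<in>?\<Gamma>. ?L (P F) A * D A B * ?L B (Q F')) = ?L (P F) (Q F')" for F F'
  proof -
    have "(\<Sum>A\<in>?\<Gamma>. \<Sum>B\<in>?\<Gamma>. ?L (P F) A * D A B * ?L B (Q F'))
        = mat_mul ?\<Gamma> (mat_mul ?\<Gamma> ?L D) ?L (P F) (Q F')"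
      unfolding mat_mul_def sum_distrib_right by (rule sum.swap)
    then show ?thesis using assms(8) P Q by simp
  qed
  have "(\<Sum>A\<in>?\<Gamma>. \<Sum>B\<in>?\<Gamma>. D A B * tutte (contract K A) x 1 * tutte (contract H B) x 1)
      = (\<Sum>A\<in>?\<Gamma>. \<Sum>B\<in>?\<Gamma>. \<Sum>F\<in>?EK. \<Sum>F'\<in>?EH.
          k F * (?L (P F) A * D A B * ?L B (Q F')) * h F')"
    by (intro sum.cong refl, simp only: tK tH mult.assoc sum_product, simp only: sum_distrib_left)
      (intro sum.cong refl, simp add: mult_ac)
  also have "\<dots> = (\<Sum>F\<in>?EK. \<Sum>F'\<in>?EH. \<Sum>A\<in>?\<Gamma>. \<Sum>B\<in>?\<Gamma>.
          k F * (?L (P F) A * D A B * ?L B (Q F')) * h F')"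
    by (rule sum_swap_pairs)
  also have "\<dots> = (\<Sum>F\<in>?EK. \<Sum>F'\<in>?EH. k F * ?L (P F) (Q F') * h F')"
    by (simp only: sum_distrib_left[symmetric] sum_distrib_right[symmetric] LDL)
  also have "\<dots> = tutte G x 1"
    using tutte_union[OF assms(1-7)] by (simp add: k_def h_def P_def Q_def)
  finally show ?thesis by (rule sym)
qed

end
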